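(* Let $(X,\mu)$ be a standard probability space, let $T$ be an aperiodic automorphism of $(X,\mu)$, and let $f \in L^1(X,\mu)$ be real-valued. For $n \ge 1$ and $x \in X$ put \[ A_f[T,n](x) := \frac{1}{n}\sum_{i=0}^{n-1} f(T^i x). \] If $T$ is ergodic, then \[ \lim_{n\to\infty} A_f[T,n](x) = \int_X f\,d\mu \quad \text{for } \mu\text{-a.e. } x \in X. \]
   Context: A standard probability space is a standard Borel space $X$ equipped with a Borel probability measure $\mu$. An automorphism $T$ of $(X,\mu)$ is a Borel bijection $T : X \to X$ (with Borel inverse) preserving $\mu$. It is aperiodic if every $T$-orbit is infinite, and ergodic if every $T$-invariant measurable set has measure $0$ or $1$. *)

theory Defs
  imports "HOL-Probability.Probability"
begin

text \<open>The Polish topology generating the \<open>\<sigma>\<close>-algebra is only required to exist; it is not part of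
  the structure and is unrelated to any topology carried by the type \<open>'a\<close>.\<close>

definition standard_borel_space :: "'a measure \<Rightarrow> bool" where
  "standard_borel_space M \<longleftrightarrow>
     (\<exists>X. completely_metrizable_space X \<and> separable_space X \<and> topspace X = space M \<and>
          sets M = sigma_sets (space M) {U. openin X U})"

definition standard_prob_space :: "'a measure \<Rightarrow> bool" where
  "standard_prob_space M \<longleftrightarrow> standard_borel_space M \<and> prob_space M"

definition mp_automorphism :: "'a measure \<Rightarrow> ('a \<Rightarrow> 'a) \<Rightarrow> bool" where
  "mp_automorphism M T \<longleftrightarrow>
     bij_betw T (space M) (space M) \<and>
     T \<in> M \<rightarrow>\<^sub>M M \<and> inv_into (space M) T \<in> M \<rightarrow>\<^sub>M M \<and>
     distr M M T = M"

text \<open>Orbits are two-sided: the action of the integers generated by \<open>T\<close>.\<close>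

definition orbit_of :: "'a measure \<Rightarrow> ('a \<Rightarrow> 'a) \<Rightarrow> 'a \<Rightarrow> 'a set" where
  "orbit_of M T x =
     range (\<lambda>n::nat. (T ^^ n) x) \<union> range (\<lambda>n::nat. (inv_into (space M) T ^^ n) x)"

definition aperiodic :: "'a measure \<Rightarrow> ('a \<Rightarrow> 'a) \<Rightarrow> bool" where
  "aperiodic M T \<longleftrightarrow> (\<forall>x\<in>space M. infinite (orbit_of M T x))"

definition ergodic :: "'a measure \<Rightarrow> ('a \<Rightarrow> 'a) \<Rightarrow> bool" where
  "ergodic M T \<longleftrightarrow>
     (\<forall>A\<in>sets M. T -` A \<inter> space M = A \<longrightarrow> measure M A = 0 \<or> measure M A = 1)"

definition ergodic_average :: "('a \<Rightarrow> real) \<Rightarrow> ('a \<Rightarrow> 'a) \<Rightarrow> nat \<Rightarrow> 'a \<Rightarrow> real" where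
  "ergodic_average f T n x = (1 / real n) * (\<Sum>i<n. f ((T ^^ i) x))"

end

theory Submission
  imports Defs
begin

text \<open>
  The heart of the matter is one-sided: if \<open>\<integral>g < 0\<close> then the Birkhoff sums
  \<open>S\<^sub>n = \<Sum>i<n. g \<circ> T\<^sup>i\<close> are almost everywhere bounded above. Applied to \<open>g = f - c\<close> for any
  \<open>c > \<integral>f\<close>, this says that \<open>S\<^sub>n f \<le> n c + O(1)\<close>, so the averages of \<open>f\<close> eventually stay below
  every number larger than \<open>\<integral>f\<close>; applied to \<open>-f\<close>, it gives the matching lower bound.

  To prove the one-sided claim, let \<open>P\<^sub>n = max (S\<^sub>0, \<dots>, S\<^sub>n)\<close>. These functions increase with \<open>n\<close>, and
  splitting off the first summand gives \<open>P\<^sub>n\<^sub>+\<^sub>1 = max 0 (g + P\<^sub>n \<circ> T)\<close>. The set where \<open>P\<^sub>n\<close> is unbounded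
  is therefore invariant, so by ergodicity it is null or conull. If it were conull, then
  \<open>P\<^sub>n\<^sub>+\<^sub>1 - P\<^sub>n \<circ> T = max (- P\<^sub>n \<circ> T) g\<close> would tend to \<open>g\<close> almost everywhere, dominated by \<open>\<bar>g\<bar>\<close>.
  Because \<open>T\<close> preserves the measure, the integral of the left-hand side is
  \<open>\<integral>(P\<^sub>n\<^sub>+\<^sub>1 - P\<^sub>n) \<ge> 0\<close>, and the limit would yield \<open>\<integral>g \<ge> 0\<close>. This argument replaces the maximal
  ergodic inequality.
\<close>

section \<open>Running maxima of Birkhoff sums\<close>

text \<open>The maximum of the Birkhoff sums of lengths \<open>0, \<dots>, n\<close>, in the recursive form
  that compares its value at \<open>x\<close> with its value at \<open>T x\<close>.\<close>

fun running_max :: "('a \<Rightarrow> 'a) \<Rightarrow> ('a \<Rightarrow> real) \<Rightarrow> nat \<Rightarrow> 'a \<Rightarrow> real" where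
  "running_max T g 0 x = 0"
| "running_max T g (Suc n) x = max 0 (g x + running_max T g n (T x))"

lemma running_max_nonneg: "0 \<le> running_max T g n x"
  by (cases n) auto

lemma running_max_le_Suc: "running_max T g n x \<le> running_max T g (Suc n) x"
proof (induction n arbitrary: x)
  case (Suc n)
  from Suc.IH[of "T x"] show ?case
    by (subst (1 2) running_max.simps(2)) linarith
qed simp

lemma running_max_mono: "m \<le> n \<Longrightarrow> running_max T g m x \<le> running_max T g n x"
  using lift_Suc_mono_le[of "\<lambda>n. running_max T g n x"] running_max_le_Suc by metis

lemma birkhoff_sum_le_running_max: "(\<Sum>i<n. g ((T ^^ i) x)) \<le> running_max T g n x"
proof (induction n arbitrary: x)
  case (Suc n)
  have "(\<Sum>i<Suc n. g ((T ^^ i) x)) = g x + (\<Sum>i<n. g ((T ^^ i) (T x)))"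
    by (subst sum.lessThan_Suc_shift) (simp add: funpow_swap1)
  with Suc.IH[of "T x"] show ?case
    by simp
qed simp

text \<open>Along an orbit the running maxima change by at most a bounded amount and a shift of the index,
  which makes their boundedness an invariant property.\<close>

lemma running_max_bounded_shift_iff:
  "(\<exists>B. \<forall>n. running_max T g n (T x) \<le> B) \<longleftrightarrow> (\<exists>B. \<forall>n. running_max T g n x \<le> B)"
proof
  assume "\<exists>B. \<forall>n. running_max T g n (T x) \<le> B"
  then obtain B where B: "\<And>n. running_max T g n (T x) \<le> B"
    by blast
  have "running_max T g n x \<le> max 0 (g x + B)" for n
    by (cases n) (use B in \<open>auto simp: max_def intro: order_trans\<close>)
  then show "\<exists>B. \<forall>n. running_max T g n x \<le> B"
    by blast
next
  assume "\<exists>B. \<forall>n. running_max T g n x \<le> B"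
  then obtain B where B: "\<And>n. running_max T g n x \<le> B"
    by blast
  have "running_max T g n (T x) \<le> B - g x" for n
    using B[of "Suc n"] by simp
  then show "\<exists>B. \<forall>n. running_max T g n (T x) \<le> B"
    by blast
qed

section \<open>Ergodic transformations of a probability space\<close>

locale ergodic_transformation = prob_space M for M :: "'a measure" +
  fixes T :: "'a \<Rightarrow> 'a"
  assumes measurable_T [measurable]: "T \<in> M \<rightarrow>\<^sub>M M"
    and distr_T: "distr M M T = M"
    and ergodic_T: "ergodic M T"
begin

lemma integrable_comp_T:
  fixes g :: "'a \<Rightarrow> real"
  assumes "integrable M g"
  shows "integrable M (\<lambda>x. g (T x))"
  using assms integrable_distr[OF measurable_T, of g] distr_T by simp

lemma integral_comp_T:
  fixes g :: "'a \<Rightarrow> real"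
  assumes "integrable M g"
  shows "(LINT x|M. g (T x)) = (LINT x|M. g x)"
  using assms integral_distr[OF measurable_T, of g] distr_T by simp

lemma integrable_running_max:
  assumes "integrable M g"
  shows "integrable M (running_max T g n)"
proof (induction n)
  case (Suc n)
  have "integrable M (\<lambda>x. max 0 (g x + running_max T g n (T x)))"
    using assms integrable_comp_T[OF Suc.IH] by (intro integrable_max) auto
  also have "(\<lambda>x. max 0 (g x + running_max T g n (T x))) = running_max T g (Suc n)"
    by (simp add: fun_eq_iff)
  finally show ?case .
qed simp

text \<open>This is the step in which ergodicity is turned into an almost sure bound: unboundedness on a
  conull set would force \<open>\<integral>g \<ge> 0\<close> by dominated convergence.\<close>

lemma AE_running_max_bounded:
  assumes g: "integrable M g" and neg: "(LINT x|M. g x) < 0"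
  shows "AE x in M. \<exists>B. \<forall>n. running_max T g n x \<le> B"
proof -
  let ?P = "running_max T g"
  have [measurable]: "g \<in> borel_measurable M" "\<And>n. ?P n \<in> borel_measurable M"
    using g integrable_running_max[OF g] by auto
  \<comment> \<open>Natural-number bounds keep the quantifiers countable, as measurability requires.\<close>
  define A where "A = {x \<in> space M. \<forall>B::nat. \<exists>n. real B < ?P n x}"
  have A_iff: "x \<in> A \<longleftrightarrow> \<not> (\<exists>B. \<forall>n. ?P n x \<le> B)" if "x \<in> space M" for x
    using that unfolding A_def
    by (simp add: not_le) (meson le_less_trans less_le_trans real_arch_simple)
  have A_meas: "A \<in> sets M"
    unfolding A_def by measurable
  have A_shift: "T x \<in> A \<longleftrightarrow> x \<in> A" if "x \<in> space M" for x
    using that measurable_space[OF measurable_T that] running_max_bounded_shift_iff[of T g x]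
    by (simp only: A_iff)
  have "T -` A \<inter> space M = A"
    using A_shift by (auto simp: A_def)
  then consider "measure M A = 0" | "measure M A = 1"
    using ergodic_T A_meas unfolding ergodic_def by blast
  then show ?thesis
  proof cases
    case 1
    then have "AE x in M. x \<notin> A"
      using A_meas by (simp add: prob_eq_0)
    then show ?thesis
      by (rule AE_mp) (auto simp: A_iff)
  next
    case 2
    then have AE_A: "AE x in M. x \<in> A"
      using A_meas by (simp add: prob_eq_1)
    let ?D = "\<lambda>n x. ?P (Suc n) x - ?P n (T x)"
    have D_eq: "?D n x = max (- ?P n (T x)) (g x)" for n x
      by simp
    have lim: "(\<lambda>n. ?D n x) \<longlonglongrightarrow> g x" if x: "x \<in> A" for x
    proof -
      have "T x \<in> A"
        using x A_shift by (simp add: A_def)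
      \<comment> \<open>Once the running maximum at \<open>T x\<close> exceeds \<open>- g x\<close>, the difference equals \<open>g x\<close>.\<close>
      then have "\<not> (\<forall>n. ?P n (T x) \<le> - g x)"
        using A_iff[of "T x"] unfolding A_def by blast
      then obtain N where N: "- g x < ?P N (T x)"
        by (auto simp: not_le)
      have "?D n x = g x" if "N \<le> n" for n
        using N running_max_mono[OF that, of T g "T x"] unfolding D_eq by linarith
      then show ?thesis
        by (intro tendsto_eventually eventually_sequentiallyI[of N])
    qed
    have "(\<lambda>n. LINT x|M. ?D n x) \<longlonglongrightarrow> (LINT x|M. g x)"
    proof (rule integral_dominated_convergence[where w = "\<lambda>x. \<bar>g x\<bar>"])
      show "AE x in M. (\<lambda>n. ?D n x) \<longlonglongrightarrow> g x"
        using AE_A lim by (auto elim: AE_mp)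
      show "AE x in M. norm (?D n x) \<le> \<bar>g x\<bar>" for n
      proof (rule AE_I2)
        fix x
        show "norm (?D n x) \<le> \<bar>g x\<bar>"
          unfolding D_eq real_norm_def using running_max_nonneg[of T g n "T x"] by linarith
      qed
      show "integrable M (\<lambda>x. \<bar>g x\<bar>)"
        using g by simp
    qed measurable
    moreover have "0 \<le> (LINT x|M. ?D n x)" for n
    proof -
      note int = integrable_running_max[OF g]
      have "(LINT x|M. ?D n x) = (LINT x|M. ?P (Suc n) x) - (LINT x|M. ?P n x)"
        using int integrable_comp_T integral_comp_T by (subst Bochner_Integration.integral_diff) auto
      then show ?thesis
        using integral_mono[OF int int running_max_le_Suc, of n] by simp
    qed
    ultimately have "0 \<le> (LINT x|M. g x)"
      by (intro LIMSEQ_le_const) auto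
    with neg show ?thesis
      by simp
  qed
qed

lemma AE_eventually_average_less:
  assumes f: "integrable M f" and c: "(LINT x|M. f x) < c"
  shows "AE x in M. \<forall>\<^sub>F n in sequentially. ergodic_average f T n x < c"
proof -
  \<comment> \<open>Room strictly below \<open>c\<close> absorbs the error \<open>B / n\<close>.\<close>
  obtain d where d: "(LINT x|M. f x) < d" "d < c"
    using dense[OF c] by blast
  let ?g = "\<lambda>x. f x - d"
  have "integrable M ?g" "(LINT x|M. ?g x) < 0"
    using f d by (simp_all add: prob_space)
  from AE_running_max_bounded[OF this] show ?thesis
  proof (rule AE_mp, intro AE_I2 impI)
    fix x
    assume "\<exists>B. \<forall>n. running_max T ?g n x \<le> B"
    then obtain B where B: "\<And>n. running_max T ?g n x \<le> B"
      by blast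
    have bound: "ergodic_average f T n x \<le> d + B / real n" if "0 < n" for n
    proof -
      have "(\<Sum>i<n. f ((T ^^ i) x)) - real n * d \<le> B"
        using birkhoff_sum_le_running_max[of ?g T x n] B[of n] by (simp add: sum_subtractf)
      then show ?thesis
        using that by (simp add: ergodic_average_def field_simps)
    qed
    have "(\<lambda>n. d + B / real n) \<longlonglongrightarrow> d + 0"
      by (intro tendsto_intros lim_const_over_n)
    then have "\<forall>\<^sub>F n in sequentially. d + B / real n < c"
      using d(2) by (intro order_tendstoD(2)) auto
    with eventually_gt_at_top[of 0]
    show "\<forall>\<^sub>F n in sequentially. ergodic_average f T n x < c"
      by eventually_elim (use bound in \<open>auto intro: le_less_trans\<close>)
  qed
qed

lemma AE_eventually_average_greater:
  assumes f: "integrable M f" and c: "c < (LINT x|M. f x)"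
  shows "AE x in M. \<forall>\<^sub>F n in sequentially. c < ergodic_average f T n x"
proof -
  have "ergodic_average (\<lambda>x. - f x) T n x = - ergodic_average f T n x" for n x
    by (simp add: ergodic_average_def sum_negf)
  with AE_eventually_average_less[of "\<lambda>x. - f x" "- c"] f c show ?thesis
    by simp
qed

text \<open>Tolerances \<open>1 / (k + 1)\<close> suffice for convergence, and there are only countably many of them,
  so the exceptional null sets can be united.\<close>

lemma AE_average_tendsto_integral:
  assumes f: "integrable M f"
  shows "AE x in M. (\<lambda>n. ergodic_average f T n x) \<longlonglongrightarrow> (LINT x|M. f x)"
proof -
  let ?c = "LINT x|M. f x" and ?e = "\<lambda>k. inverse (real (Suc k))"
  have "AE x in M. \<forall>k. (\<forall>\<^sub>F n in sequentially. ergodic_average f T n x < ?c + ?e k) \<and>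
      (\<forall>\<^sub>F n in sequentially. ?c - ?e k < ergodic_average f T n x)"
    unfolding AE_all_countable AE_conj_iff
    by (intro allI conjI AE_eventually_average_less AE_eventually_average_greater f) auto
  then show ?thesis
  proof (rule AE_mp, intro AE_I2 impI tendstoI)
    fix x and r :: real
    assume near: "\<forall>k. (\<forall>\<^sub>F n in sequentially. ergodic_average f T n x < ?c + ?e k) \<and>
      (\<forall>\<^sub>F n in sequentially. ?c - ?e k < ergodic_average f T n x)"
    assume "0 < r"
    then obtain k where k: "?e k < r"
      using reals_Archimedean by blast
    have "\<forall>\<^sub>F n in sequentially. ergodic_average f T n x < ?c + ?e k"
      "\<forall>\<^sub>F n in sequentially. ?c - ?e k < ergodic_average f T n x"
      using near by auto
    then show "\<forall>\<^sub>F n in sequentially. dist (ergodic_average f T n x) ?c < r"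
      by eventually_elim (use k in \<open>unfold dist_real_def, linarith\<close>)
  qed
qed

end

section \<open>The pointwise ergodic theorem\<close>

theorem theorem3:
  fixes M :: "'a measure" and T :: "'a \<Rightarrow> 'a" and f :: "'a \<Rightarrow> real"
  assumes "standard_prob_space M"
    and "mp_automorphism M T"
    and "aperiodic M T"
    and "integrable M f"
    and "ergodic M T"
  shows "AE x in M. (\<lambda>n. ergodic_average f T n x) \<longlonglongrightarrow> (LINT x|M. f x)"
proof -
  interpret prob_space M
    using assms(1) by (simp add: standard_prob_space_def)
  interpret ergodic_transformation M T
    using assms(2,5) by unfold_locales (auto simp: mp_automorphism_def)
  show ?thesis
    using assms(4) by (rule AE_average_tendsto_integral)
qed

end
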